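(* Let $(a_n)_{n\ge 1}$ be a sequence of real numbers such that $a_n\to 0$ and $(a_n)\notin \ell^1$, i.e. $\sum_{n=1}^\infty |a_n|=\infty$. Then for every $L\in\mathbb{R}$, $$\dim\left\{\varepsilon=(\varepsilon_n)_{n\ge1} \in \Omega:\ \sum_{n=1}^\infty \varepsilon_n a_n = L \right\}=1.$$
   Context: $\Omega=\{-1,1\}^{\mathbb{N}}$ (with $\mathbb{N}=\{1,2,\dots\}$) is the set of infinite sign sequences, equipped with the ultrametric $\rho(\varepsilon,\omega)=2^{-\min\{n:\ \varepsilon_n\neq\omega_n\}}$ for $\varepsilon\ne\omega$, and $\rho(\varepsilon,\varepsilon)=0$. $\dim$ denotes Hausdorff dimension of subsets of $(\Omega,\rho)$. The condition $\sum_{n=1}^\infty \varepsilon_n a_n = L$ means that the partial sums converge to $L$. *)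

theory Defs
  imports "HOL-Analysis.Analysis"
begin

section \<open>Hausdorff measure and dimension in a metric space\<close>

context Metric_space
begin

definition ediam :: "'a set \<Rightarrow> ennreal" where
  "ediam U = (SUP x\<in>U. SUP y\<in>U. ennreal (d x y))"

text \<open>
  The \<open>s\<close>-th power of the diameter, for \<open>s \<ge> 0\<close> and \<open>U\<close> of finite diameter. The case \<open>s = 0\<close>
  is separate because \<open>0 powr 0 = 0\<close> in the library, whereas the usual convention is that
  every nonempty set contributes 1 (so that the 0-dimensional measure counts points).
\<close>
definition diam_pow :: "real \<Rightarrow> 'a set \<Rightarrow> ennreal" where
  "diam_pow s U =
     (if U = {} then 0 else if s = 0 then 1 else ennreal (enn2real (ediam U) powr s))"

text \<open>Finite covers are included, since the covering sets may be empty.\<close>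
definition delta_covers :: "real \<Rightarrow> 'a set \<Rightarrow> (nat \<Rightarrow> 'a set) set" where
  "delta_covers \<delta> A =
     {U. (\<forall>i. U i \<subseteq> M \<and> ediam (U i) \<le> ennreal \<delta>) \<and> A \<subseteq> (\<Union>i. U i)}"

definition hausdorff_premeasure :: "real \<Rightarrow> real \<Rightarrow> 'a set \<Rightarrow> ennreal" where
  "hausdorff_premeasure s \<delta> A = (INF U\<in>delta_covers \<delta> A. \<Sum>i. diam_pow s (U i))"

definition hausdorff_measure :: "real \<Rightarrow> 'a set \<Rightarrow> ennreal" where
  "hausdorff_measure s A = (SUP \<delta>\<in>{0<..}. hausdorff_premeasure s \<delta> A)"

text \<open>The value is \<open>\<infinity>\<close> if no \<open>s\<close> qualifies.\<close>
definition hausdorff_dim :: "'a set \<Rightarrow> ennreal" where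
  "hausdorff_dim A = (INF s\<in>{s. 0 \<le> s \<and> hausdorff_measure s A = 0}. ennreal s)"

end


section \<open>The space of sign sequences\<close>

text \<open>
  Sequences are indexed by the positive integers; the extensional function space fixes the
  irrelevant value at 0.
\<close>
definition Signs :: "(nat \<Rightarrow> real) set" where
  "Signs = {1..} \<rightarrow>\<^sub>E {-1, 1}"

definition rho :: "(nat \<Rightarrow> real) \<Rightarrow> (nat \<Rightarrow> real) \<Rightarrow> real" where
  "rho \<epsilon> \<omega> = (if \<epsilon> = \<omega> then 0 else 1 / 2 ^ (LEAST n. 1 \<le> n \<and> \<epsilon> n \<noteq> \<omega> n))"

lemma rho_commute: "rho \<epsilon> \<omega> = rho \<omega> \<epsilon>"
proof -
  have "(\<lambda>n. 1 \<le> n \<and> \<epsilon> n \<noteq> \<omega> n) = (\<lambda>n. 1 \<le> n \<and> \<omega> n \<noteq> \<epsilon> n)"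
    by auto
  then show ?thesis by (auto simp: rho_def)
qed

lemma Signs_neq_ex:
  assumes "\<epsilon> \<in> Signs" "\<omega> \<in> Signs" "\<epsilon> \<noteq> \<omega>"
  shows "\<exists>n. 1 \<le> n \<and> \<epsilon> n \<noteq> \<omega> n"
  using assms PiE_ext[of \<epsilon> "{1..}" _ \<omega>] unfolding Signs_def by fastforce

lemma rho_ultrametric:
  assumes S: "\<epsilon> \<in> Signs" "\<omega> \<in> Signs" "\<zeta> \<in> Signs"
  shows "rho \<epsilon> \<zeta> \<le> max (rho \<epsilon> \<omega>) (rho \<omega> \<zeta>)"
proof (cases "\<epsilon> = \<zeta> \<or> \<epsilon> = \<omega> \<or> \<omega> = \<zeta>")
  case True
  then show ?thesis by (auto simp: rho_def le_max_iff_disj)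
next
  case False
  define k where "k = (LEAST n. 1 \<le> n \<and> \<epsilon> n \<noteq> \<zeta> n)"
  have k: "1 \<le> k \<and> \<epsilon> k \<noteq> \<zeta> k"
    unfolding k_def by (rule LeastI_ex) (use Signs_neq_ex[of \<epsilon> \<zeta>] S False in blast)
  have le: "1 / 2 ^ k \<le> rho \<alpha> \<beta>" if "\<alpha> k \<noteq> \<beta> k" for \<alpha> \<beta>
  proof -
    have "(LEAST n. 1 \<le> n \<and> \<alpha> n \<noteq> \<beta> n) \<le> k"
      using k that by (intro Least_le) simp
    then have "(1::real) / 2 ^ k \<le> 1 / 2 ^ (LEAST n. 1 \<le> n \<and> \<alpha> n \<noteq> \<beta> n)"
      by (intro divide_left_mono power_increasing) simp_all
    moreover have "\<alpha> \<noteq> \<beta>"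
      using that by blast
    ultimately show ?thesis by (simp add: rho_def)
  qed
  have "\<epsilon> k \<noteq> \<omega> k \<or> \<omega> k \<noteq> \<zeta> k"
    using k by metis
  moreover have "rho \<epsilon> \<zeta> = 1 / 2 ^ k"
    using False by (simp add: rho_def k_def)
  ultimately show ?thesis
    using le[of \<epsilon> \<omega>] le[of \<omega> \<zeta>] by linarith
qed

interpretation Signs: Metric_space Signs rho
proof
  show nonneg: "0 \<le> rho \<epsilon> \<omega>" for \<epsilon> \<omega>
    by (simp add: rho_def)
  show "rho \<epsilon> \<omega> = rho \<omega> \<epsilon>" for \<epsilon> \<omega>
    by (rule rho_commute)
  show "rho \<epsilon> \<omega> = 0 \<longleftrightarrow> \<epsilon> = \<omega>" for \<epsilon> \<omega>
    by (simp add: rho_def)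
  show "rho \<epsilon> \<zeta> \<le> rho \<epsilon> \<omega> + rho \<omega> \<zeta>"
    if "\<epsilon> \<in> Signs" "\<omega> \<in> Signs" "\<zeta> \<in> Signs" for \<epsilon> \<omega> \<zeta>
    using rho_ultrametric[OF that] nonneg[of \<epsilon> \<omega>] nonneg[of \<omega> \<zeta>] by linarith
qed

end

theory Submission
  imports Defs
begin

text \<open>
  Cut the indices into blocks of a fixed length \<open>m\<close> and let \<open>D\<close> be the current partial sum minus
  \<open>L\<close>. Among the \<open>2 ^ m\<close> sign words of the next block at least a quarter give a block sum that is
  opposite in sign to \<open>D\<close> and at least as large as every term of the block: flipping the sign
  of the largest term and negating the whole word each cost at most a factor 2. If only such words
  are used, the block sums tend to 0, are not absolutely summable and push \<open>D\<close> towards 0, so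
  the series converges to \<open>L\<close>. Prescribing the choices by the digits of \<open>x \<in> [0, 1)\<close> in base
  \<open>2 ^ (m - 2)\<close> gives a map from \<open>[0, 1)\<close> into the set whose inverse is Hoelder with exponent
  \<open>(m - 2) / m\<close>; comparison with Lebesgue measure bounds the dimension below by this exponent.
\<close>

section \<open>Hausdorff measure and dimension\<close>

context Metric_space
begin

text \<open>The bound by \<open>c\<close> excludes an infinite diameter, which
  \<open>enn2real\<close> would turn into 0.\<close>

lemma dist_le_ediam:
  assumes "x \<in> U" "y \<in> U" "ediam U \<le> ennreal c"
  shows "d x y \<le> enn2real (ediam U)"
proof -
  have "ennreal (d x y) \<le> ediam U"
    unfolding ediam_def using assms by (meson SUP_upper2 order_refl)
  moreover have "ediam U < top"
    using assms(3) by (meson ennreal_less_top le_less_trans)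
  ultimately show ?thesis
    by (metis enn2real_ennreal enn2real_mono nonneg)
qed

text \<open>The preimages under \<open>g\<close> of a cover of \<open>A\<close> cover [0, 1), and
  the Hoelder bound puts each of them into an interval of radius \<open>C\<close> times the
  \<open>s\<close>-th power of the diameter. The lengths of these intervals add up to at least 1, so
  the diameter sums stay away from 0.\<close>

lemma hausdorff_measure_neq_0:
  fixes g :: "real \<Rightarrow> 'a"
  assumes g: "g ` {0..<1} \<subseteq> A" and C: "0 < C" and ts: "0 \<le> t" "t \<le> s" "0 < s"
    and hol: "\<And>x y. x \<in> {0..<1} \<Longrightarrow> y \<in> {0..<1} \<Longrightarrow> \<bar>x - y\<bar> \<le> C * d (g x) (g y) powr s"
  shows "hausdorff_measure t A \<noteq> 0"
proof -
  \<comment> \<open>The scale 1 makes all diameters at most 1, so that the exponent \<open>s\<close>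
    may be lowered to \<open>t\<close>. The factor 2 comes from passing from radius to
    length.\<close>
  have lower: "ennreal (1 / (2 * C)) \<le> (\<Sum>i. diam_pow t (U i))" if U: "U \<in> delta_covers 1 A" for U
  proof -
    have ed: "ediam (U i) \<le> ennreal 1" for i
      using U by (simp add: delta_covers_def)
    define V where "V i = {x \<in> {0..<1}. g x \<in> U i}" for i
    define r where "r i = C * enn2real (ediam (U i)) powr s" for i
    have r: "0 \<le> r i" for i
      using C by (simp add: r_def)
    have "\<exists>x. V i \<subseteq> cball x (r i)" for i
    proof (cases "V i = {}")
      case False
      then obtain x where x: "x \<in> V i" by blast
      have "dist x y \<le> r i" if y: "y \<in> V i" for y
      proof -
        have "\<bar>x - y\<bar> \<le> C * d (g x) (g y) powr s"
          using x y hol by (simp add: V_def)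
        also have "\<dots> \<le> r i"
          unfolding r_def using C ts x y dist_le_ediam[OF _ _ ed]
          by (intro mult_left_mono powr_mono2) (auto simp: V_def)
        finally show ?thesis by (simp add: dist_real_def)
      qed
      then show ?thesis by (auto simp: subset_iff)
    qed auto
    then obtain z where z: "\<And>i. V i \<subseteq> cball (z i) (r i)" by metis
    \<comment> \<open>Closed balls replace the preimages \<open>V i\<close>, which may fail to be
      measurable.\<close>
    define W where "W i = (if U i = {} then {} else cball (z i) (r i))" for i
    have W: "emeasure lborel (W i) \<le> ennreal (2 * C) * diam_pow t (U i)" for i
    proof (cases "U i = {}")
      case False
      define e where "e = enn2real (ediam (U i))"
      have e: "0 \<le> e" "e \<le> 1"
        using enn2real_mono[OF ed[of i]] by (auto simp: e_def)
      have "ennreal (e powr s) \<le> diam_pow t (U i)"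
      proof (cases "t = 0")
        case True
        then show ?thesis
          using False e ts by (simp add: diam_pow_def powr_le1)
      next
        case t: False
        have "e powr s \<le> e powr t"
          using e ts by (cases "e = 0") (auto intro: powr_mono')
        then show ?thesis
          using False t by (auto simp: diam_pow_def e_def ennreal_leI)
      qed
      then have "ennreal (2 * C) * ennreal (e powr s) \<le> ennreal (2 * C) * diam_pow t (U i)"
        by (rule mult_left_mono) simp
      moreover have "emeasure lborel (W i) = ennreal (2 * C) * ennreal (e powr s)"
        using False C r[of i]
        by (simp add: W_def cball_eq_atLeastAtMost r_def e_def mult.assoc flip: ennreal_mult)
      ultimately show ?thesis by simp
    qed (simp add: W_def)
    have "{0..<1} \<subseteq> (\<Union>i. W i)"
    proof
      fix x :: real assume x: "x \<in> {0..<1}"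
      then obtain i where "g x \<in> U i"
        using U g unfolding delta_covers_def by blast
      then have "x \<in> W i"
        using x z[of i] by (auto simp: W_def V_def)
      then show "x \<in> (\<Union>i. W i)" by blast
    qed
    then have "1 \<le> emeasure lborel (\<Union>i. W i)"
      using emeasure_mono[of "{0..<1::real}" "\<Union>i. W i" lborel] by (simp add: W_def)
    also have "\<dots> \<le> (\<Sum>i. emeasure lborel (W i))"
      by (rule emeasure_subadditive_countably) (auto simp: W_def)
    also have "\<dots> \<le> (\<Sum>i. ennreal (2 * C) * diam_pow t (U i))"
      by (intro suminf_le W) auto
    also have "\<dots> = ennreal (2 * C) * (\<Sum>i. diam_pow t (U i))"
      by simp
    finally have "ennreal (1 / (2 * C)) * 1
        \<le> ennreal (1 / (2 * C)) * (ennreal (2 * C) * (\<Sum>i. diam_pow t (U i)))"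
      by (rule mult_left_mono) simp
    also have "\<dots> = (\<Sum>i. diam_pow t (U i))"
    proof -
      have "ennreal (1 / (2 * C)) * ennreal (2 * C) = 1"
        using C by (subst ennreal_mult[symmetric]) auto
      then show ?thesis
        by (metis mult.assoc mult_1)
    qed
    finally show ?thesis by simp
  qed
  have "ennreal (1 / (2 * C)) \<le> hausdorff_premeasure t 1 A"
    unfolding hausdorff_premeasure_def by (rule INF_greatest) (rule lower)
  also have "\<dots> \<le> hausdorff_measure t A"
    unfolding hausdorff_measure_def by (rule SUP_upper) simp
  finally show ?thesis
    using C by (auto simp: ennreal_eq_0_iff)
qed

end

section \<open>Upper bound for the dimension of sets of sign sequences\<close>

lemma rho_le_if_agree:
  assumes "\<epsilon> \<in> Signs" "\<omega> \<in> Signs" and agree: "\<And>i. i \<in> {1..n} \<Longrightarrow> \<epsilon> i = \<omega> i"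
  shows "rho \<epsilon> \<omega> \<le> 1 / 2 ^ n"
proof (cases "\<epsilon> = \<omega>")
  case False
  define k where "k = (LEAST n. 1 \<le> n \<and> \<epsilon> n \<noteq> \<omega> n)"
  have k: "1 \<le> k \<and> \<epsilon> k \<noteq> \<omega> k"
    unfolding k_def by (rule LeastI_ex) (use Signs_neq_ex assms False in blast)
  then have "n \<le> k"
    using agree[of k] by (meson atLeastAtMost_iff linear)
  moreover have "rho \<epsilon> \<omega> = 1 / 2 ^ k"
    using False by (simp add: rho_def k_def)
  ultimately show ?thesis
    by (simp add: frac_le)
qed (simp add: rho_def)

text \<open>The \<open>2 ^ n\<close> cylinders that fix the first \<open>n\<close> signs have
  diameter at most \<open>1 / 2 ^ n\<close>, so their contribution is at most
  \<open>2 ^ n * (1 / 2 ^ n) powr s\<close>, which tends to 0.\<close>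

lemma hausdorff_measure_Signs_eq_0:
  assumes A: "A \<subseteq> Signs" and s: "1 < s"
  shows "Signs.hausdorff_measure s A = 0"
proof -
  have "Signs.hausdorff_premeasure s \<delta> A = 0" if \<delta>: "0 < \<delta>" for \<delta>
  proof -
    have upper: "Signs.hausdorff_premeasure s \<delta> A \<le> ennreal ((2 powr (1 - s)) ^ n)"
      if n: "1 / 2 ^ n \<le> \<delta>" for n :: nat
    proof -
      obtain f where f: "bij_betw f {0..<(2::nat) ^ n} (Pow {1..n})"
        using ex_bij_betw_nat_finite[of "Pow {1..n}"] by (auto simp: card_Pow)
      \<comment> \<open>The set \<open>f i\<close> lists the positions with sign 1 in the
        \<open>i\<close>-th cylinder. A cover is an infinite sequence, so it is padded with empty
        sets, which contribute 0.\<close>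
      define U where "U i = (if i < 2 ^ n
          then {\<epsilon> \<in> Signs. \<forall>j\<in>{1..n}. \<epsilon> j = 1 \<longleftrightarrow> j \<in> f i} else {})" for i
      have ed: "Signs.ediam (U i) \<le> ennreal (1 / 2 ^ n)" for i
        unfolding Signs.ediam_def
      proof (intro SUP_least ennreal_leI)
        fix \<epsilon> \<omega> assume *: "\<epsilon> \<in> U i" "\<omega> \<in> U i"
        have "\<epsilon> j = \<omega> j" if j: "j \<in> {1..n}" for j
        proof -
          have "\<epsilon> j \<in> {-1, 1}" "\<omega> j \<in> {-1, 1}" "\<epsilon> j = 1 \<longleftrightarrow> \<omega> j = 1"
            using * j by (auto simp: U_def Signs_def PiE_iff split: if_splits)
          then show ?thesis by auto
        qed
        then show "rho \<epsilon> \<omega> \<le> 1 / 2 ^ n"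
          using * by (intro rho_le_if_agree) (auto simp: U_def split: if_splits)
      qed
      have "A \<subseteq> (\<Union>i. U i)"
      proof
        fix \<epsilon> assume \<epsilon>: "\<epsilon> \<in> A"
        have "{j \<in> {1..n}. \<epsilon> j = 1} \<in> f ` {0..<2 ^ n}"
          using f by (auto simp: bij_betw_def)
        then obtain i where "i < 2 ^ n" "f i = {j \<in> {1..n}. \<epsilon> j = 1}"
          by (auto simp del: Collect_conj_eq)
        then have "\<epsilon> \<in> U i"
          using \<epsilon> A by (auto simp: U_def)
        then show "\<epsilon> \<in> (\<Union>i. U i)" by blast
      qed
      moreover have "Signs.ediam (U i) \<le> ennreal \<delta>" for i
        using ed[of i] ennreal_leI[OF n] by (rule order_trans)
      ultimately have "U \<in> Signs.delta_covers \<delta> A"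
        by (auto simp: Signs.delta_covers_def U_def)
      then have "Signs.hausdorff_premeasure s \<delta> A \<le> (\<Sum>i. Signs.diam_pow s (U i))"
        unfolding Signs.hausdorff_premeasure_def by (rule INF_lower)
      also have "\<dots> = (\<Sum>i<2 ^ n. Signs.diam_pow s (U i))"
        by (rule suminf_finite) (auto simp: U_def Signs.diam_pow_def)
      also have "\<dots> \<le> (\<Sum>i<(2::nat) ^ n. ennreal ((1 / 2 ^ n) powr s))"
      proof (rule sum_mono)
        fix i
        have "enn2real (Signs.ediam (U i)) \<le> 1 / 2 ^ n"
          using enn2real_mono[OF ed[of i]] by simp
        then have "enn2real (Signs.ediam (U i)) powr s \<le> (1 / 2 ^ n) powr s"
          using s by (intro powr_mono2) auto
        then show "Signs.diam_pow s (U i) \<le> ennreal ((1 / 2 ^ n) powr s)"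
          using s by (auto simp: Signs.diam_pow_def ennreal_leI)
      qed
      also have "\<dots> = ennreal (2 ^ n * (1 / 2 ^ n) powr s)"
        by (simp add: ennreal_mult' flip: ennreal_power)
      also have "2 ^ n * (1 / 2 ^ n) powr s = (2 powr (1 - s)) ^ n"
        by (simp add: powr_divide powr_diff power_divide powr_powr mult.commute flip: powr_realpow)
      finally show ?thesis .
    qed
    have "(\<lambda>n. (2 powr (1 - s)) ^ n) \<longlonglongrightarrow> 0"
      using s by (intro LIMSEQ_realpow_zero) (auto simp: powr_less_one)
    then have lim: "(\<lambda>n. ennreal ((2 powr (1 - s)) ^ n)) \<longlonglongrightarrow> 0"
      using tendsto_ennrealI by fastforce
    have "(\<lambda>n. (1 / 2 :: real) ^ n) \<longlonglongrightarrow> 0"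
      by (rule LIMSEQ_realpow_zero) auto
    then have "\<forall>\<^sub>F n in sequentially. (1 / 2 :: real) ^ n < \<delta>"
      using \<delta> by (rule order_tendstoD)
    then have "\<forall>\<^sub>F n in sequentially.
        Signs.hausdorff_premeasure s \<delta> A \<le> ennreal ((2 powr (1 - s)) ^ n)"
      by eventually_elim (rule upper, simp add: power_divide)
    then have "Signs.hausdorff_premeasure s \<delta> A \<le> 0"
      using lim by (intro tendsto_lowerbound) auto
    then show ?thesis by simp
  qed
  then show ?thesis
    by (auto simp: Signs.hausdorff_measure_def)
qed

lemma hausdorff_dim_Signs_le_1:
  assumes "A \<subseteq> Signs"
  shows "Signs.hausdorff_dim A \<le> 1"
proof (rule ennreal_le_epsilon)
  fix e :: real assume e: "0 < e"
  have "Signs.hausdorff_dim A \<le> ennreal (1 + e)"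
    unfolding Signs.hausdorff_dim_def
    using e hausdorff_measure_Signs_eq_0[OF assms] by (intro INF_lower) auto
  then show "Signs.hausdorff_dim A \<le> 1 + ennreal e"
    using e by simp
qed

section \<open>Sign words with a prescribed drift\<close>

text \<open>A sign word is encoded by the set of its positions with sign 1, so that negating a word
  means taking a complement.\<close>

definition sgn_of :: "nat set \<Rightarrow> nat \<Rightarrow> real" where
  "sgn_of X i = (if i \<in> X then 1 else -1)"

definition signed_sum :: "nat \<Rightarrow> (nat \<Rightarrow> real) \<Rightarrow> nat set \<Rightarrow> real" where
  "signed_sum m b X = (\<Sum>i<m. sgn_of X i * b i)"

text \<open>Dominating every term keeps the block sums from being absolutely summable; the sign
  condition directs the block sum against \<open>D\<close>.\<close>

definition steering_words :: "nat \<Rightarrow> (nat \<Rightarrow> real) \<Rightarrow> real \<Rightarrow> nat set set" where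
  "steering_words m b D = {X \<in> Pow {..<m}.
     (\<forall>i<m. \<bar>b i\<bar> \<le> \<bar>signed_sum m b X\<bar>) \<and> signed_sum m b X * D \<le> 0}"

lemma abs_sgn_of [simp]: "\<bar>sgn_of X i\<bar> = 1"
  by (simp add: sgn_of_def)

lemma signed_sum_Compl: "signed_sum m b ({..<m} - X) = - signed_sum m b X"
  unfolding signed_sum_def sum_negf[symmetric] by (rule sum.cong) (auto simp: sgn_of_def)

text \<open>Each element of \<open>A\<close> lies in \<open>B\<close> or is sent there by
  \<open>f\<close>; by injectivity each kind has at most \<open>card B\<close> elements.\<close>

lemma card_le_double:
  assumes "finite B" "inj_on f A" "\<And>x. x \<in> A \<Longrightarrow> x \<in> B \<or> f x \<in> B"
  shows "card A \<le> 2 * card B"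
proof -
  have "card {x \<in> A. f x \<in> B} \<le> card B"
    using assms by (intro card_inj_on_le[of f]) (auto intro: inj_on_subset)
  moreover have "finite {x \<in> A. f x \<in> B}"
    by (rule inj_on_finite[of f _ B]) (use assms in \<open>auto intro: inj_on_subset\<close>)
  then have "card A \<le> card (B \<union> {x \<in> A. f x \<in> B})"
    using assms by (intro card_mono) auto
  ultimately show ?thesis
    using card_Un_le[of B "{x \<in> A. f x \<in> B}"] by linarith
qed

lemma card_steering_words:
  assumes "2 \<le> m"
  shows "2 ^ (m - 2) \<le> card (steering_words m b D)"
proof -
  define P where "P = {X \<in> Pow {..<m}. \<forall>i<m. \<bar>b i\<bar> \<le> \<bar>signed_sum m b X\<bar>}"
  have fin: "finite P" "finite (steering_words m b D)"
    by (simp_all add: P_def steering_words_def)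
  have "Max ((\<lambda>i. \<bar>b i\<bar>) ` {..<m}) \<in> (\<lambda>i. \<bar>b i\<bar>) ` {..<m}"
    using assms by (intro Max_in) (auto simp: lessThan_empty_iff)
  then obtain j where j: "j < m" "\<bar>b j\<bar> = Max ((\<lambda>i. \<bar>b i\<bar>) ` {..<m})" by auto
  have jmax: "\<bar>b i\<bar> \<le> \<bar>b j\<bar>" if "i < m" for i
    unfolding j(2) using that by (intro Max_ge) auto
  define flip where "flip X = (if j \<in> X then X - {j} else insert j X)" for X
  have "card (Pow {..<m}) \<le> 2 * card P"
  proof (rule card_le_double[OF fin(1), of flip])
    show "inj_on flip (Pow {..<m})"
      by (rule inj_on_inverseI[of _ flip]) (auto simp: flip_def)
    fix X assume X: "X \<in> Pow {..<m}"
    define R where "R = (\<Sum>i\<in>{..<m} - {j}. sgn_of X i * b i)"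
    have "signed_sum m b X = sgn_of X j * b j + R"
      unfolding signed_sum_def R_def using j by (intro sum.remove) auto
    moreover have "signed_sum m b (flip X) = sgn_of (flip X) j * b j + R"
    proof -
      have "R = (\<Sum>i\<in>{..<m} - {j}. sgn_of (flip X) i * b i)"
        unfolding R_def by (rule sum.cong) (auto simp: sgn_of_def flip_def)
      then show ?thesis
        unfolding signed_sum_def using j by (simp add: sum.remove)
    qed
    moreover have "sgn_of (flip X) j = - sgn_of X j"
      by (auto simp: sgn_of_def flip_def)
    \<comment> \<open>The two sums differ by \<open>2 * \<bar>b j\<bar>\<close>, so they cannot both
      be smaller than \<open>\<bar>b j\<bar>\<close> in absolute value.\<close>
    ultimately have "\<bar>b j\<bar> \<le> \<bar>signed_sum m b X\<bar> \<or> \<bar>b j\<bar> \<le> \<bar>signed_sum m b (flip X)\<bar>"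
      by (auto simp: sgn_of_def)
    moreover have "flip X \<in> Pow {..<m}"
      using X j by (auto simp: flip_def)
    ultimately show "X \<in> P \<or> flip X \<in> P"
      using X jmax by (fastforce simp: P_def)
  qed
  moreover have "card P \<le> 2 * card (steering_words m b D)"
  proof (rule card_le_double[OF fin(2), of "\<lambda>X. {..<m} - X"])
    show "inj_on (\<lambda>X. {..<m} - X) P"
      by (rule inj_on_inverseI[of _ "\<lambda>X. {..<m} - X"]) (auto simp: P_def)
    fix X assume "X \<in> P"
    then show "X \<in> steering_words m b D \<or> {..<m} - X \<in> steering_words m b D"
      by (auto simp: P_def steering_words_def signed_sum_Compl)
  qed
  moreover have "2 ^ m = 4 * (2 ^ (m - 2) :: nat)"
    using assms by (auto simp: le_iff_add power_add)
  ultimately show ?thesis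
    by (simp add: card_Pow)
qed

text \<open>Once the steps are smaller than \<open>e\<close>, a value of \<open>D\<close> outside
  (-e, e) cannot jump across 0, so its absolute value drops by the full step. As the steps are not
  summable, \<open>D\<close> must enter (-e, e), and it never leaves again.\<close>

lemma steered_tendsto_0:
  fixes D B :: "nat \<Rightarrow> real"
  assumes step: "\<And>k. D (Suc k) = D k + B k" and opp: "\<And>k. B k * D k \<le> 0"
    and B0: "B \<longlonglongrightarrow> 0" and div: "\<not> summable (\<lambda>k. \<bar>B k\<bar>)"
  shows "D \<longlonglongrightarrow> 0"
proof (rule LIMSEQ_I)
  fix e :: real assume e: "0 < e"
  obtain N where N: "\<And>k. N \<le> k \<Longrightarrow> \<bar>B k\<bar> < e"
    using LIMSEQ_D[OF B0 e] by auto
  have "\<exists>k\<ge>N. \<bar>D k\<bar> < e"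
  proof (rule ccontr)
    assume "\<not> (\<exists>k\<ge>N. \<bar>D k\<bar> < e)"
    then have big: "e \<le> \<bar>D k\<bar>" if "N \<le> k" for k
      using that by force
    have dec: "\<bar>D (Suc k)\<bar> = \<bar>D k\<bar> - \<bar>B k\<bar>" if "N \<le> k" for k
      using big[OF that] N[OF that] opp[of k] step[of k] e
      by (auto simp: mult_le_0_iff abs_if split: if_splits)
    have "(\<Sum>i<n. \<bar>B (i + N)\<bar>) = \<bar>D N\<bar> - \<bar>D (n + N)\<bar>" for n
      by (induction n) (simp_all add: dec)
    then have "summable (\<lambda>i. \<bar>B (i + N)\<bar>)"
      by (intro summableI_nonneg_bounded[of _ "\<bar>D N\<bar>"]) auto
    with div show False
      using summable_iff_shift[of "\<lambda>k. \<bar>B k\<bar>" N] by simp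
  qed
  then obtain K where K: "N \<le> K" "\<bar>D K\<bar> < e" by blast
  \<comment> \<open>A step may overshoot 0, but being opposed to \<open>D k\<close> and shorter than
    \<open>e\<close> it ends inside (-e, e).\<close>
  have "\<bar>D k\<bar> < e" if "K \<le> k" for k
    using that
  proof (induction rule: dec_induct)
    case (step k)
    then show ?case
      using N[of k] K opp[of k] assms(1)[of k] by (auto simp: mult_le_0_iff abs_if split: if_splits)
  qed (rule K)
  then show "\<exists>no. \<forall>k\<ge>no. norm (D k - 0) < e" by auto
qed

section \<open>Block-wise steered sign sequences\<close>

text \<open>For each block \<open>k\<close> and deviation \<open>D\<close>, the map
  \<open>h k D\<close> encodes a digit as a steering word. Injectivity makes the digit recoverable,
  and \<open>3 \<le> m\<close> provides at least two digits.\<close>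

locale block_steering =
  fixes a :: "nat \<Rightarrow> real" and L :: real and m :: nat
    and h :: "nat \<Rightarrow> real \<Rightarrow> nat \<Rightarrow> nat set"
  assumes a_tendsto_0: "a \<longlonglongrightarrow> 0" and a_not_summable: "\<not> summable (\<lambda>n. \<bar>a (Suc n)\<bar>)"
    and m: "3 \<le> m"
    and h_inj: "\<And>k D. inj_on (h k D) {..<2 ^ (m - 2)}"
    and h_steering: "\<And>k D c. c < 2 ^ (m - 2) \<Longrightarrow>
      h k D c \<in> steering_words m (\<lambda>i. a (Suc (k * m + i))) D"
begin

abbreviation block :: "nat \<Rightarrow> nat \<Rightarrow> real" where
  "block k i \<equiv> a (Suc (k * m + i))"

text \<open>This is the partial sum over the first \<open>k\<close> blocks minus \<open>L\<close>,
  for the digit sequence \<open>c\<close>. Each word depends on it, hence on all earlier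
  digits.\<close>

primrec deviation :: "(nat \<Rightarrow> nat) \<Rightarrow> nat \<Rightarrow> real" where
  "deviation c 0 = - L"
| "deviation c (Suc k) = deviation c k + signed_sum m (block k) (h k (deviation c k) (c k))"

definition word :: "(nat \<Rightarrow> nat) \<Rightarrow> nat \<Rightarrow> nat set" where
  "word c k = h k (deviation c k) (c k)"

text \<open>Signs are indexed from 1, hence \<open>n - 1\<close>; the value at 0 is the one that
  \<open>Signs\<close> demands of extensional functions.\<close>

definition signs :: "(nat \<Rightarrow> nat) \<Rightarrow> nat \<Rightarrow> real" where
  "signs c n = (if n = 0 then undefined else sgn_of (word c ((n - 1) div m)) ((n - 1) mod m))"

lemma signs_in_Signs: "signs c \<in> Signs"
  by (auto simp: Signs_def PiE_iff extensional_def signs_def sgn_of_def)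

lemma signs_block: "i < m \<Longrightarrow> signs c (Suc (k * m + i)) = sgn_of (word c k) i"
  by (simp add: signs_def)

lemma block_sum_tendsto_0: "(\<lambda>k. \<Sum>i<m. \<bar>block k i\<bar>) \<longlonglongrightarrow> 0"
proof (rule tendsto_null_sum)
  fix i
  have "filterlim (\<lambda>k. Suc (k * m + i)) sequentially sequentially"
    using m by (intro filterlim_subseq strict_monoI) simp
  then show "(\<lambda>k. \<bar>block k i\<bar>) \<longlonglongrightarrow> 0"
    using filterlim_compose[OF a_tendsto_0] tendsto_rabs_zero by blast
qed

lemma sum_blocks:
  fixes f :: "nat \<Rightarrow> real"
  shows "(\<Sum>n=1..K * m. f n) = (\<Sum>k<K. \<Sum>i<m. f (Suc (k * m + i)))"
proof -
  have "(\<Sum>n=1..K * m. f n) = (\<Sum>n<K * m. f (Suc n))"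
    by (simp add: sum.atLeast1_atMost_eq)
  also have "\<dots> = (\<Sum>k<K. \<Sum>n=k * m..<k * m + m. f (Suc n))"
    by (rule sum.nat_group[symmetric])
  also have "\<dots> = (\<Sum>k<K. \<Sum>i<m. f (Suc (k * m + i)))"
  proof (rule sum.cong)
    fix k
    show "(\<Sum>n=k * m..<k * m + m. f (Suc n)) = (\<Sum>i<m. f (Suc (k * m + i)))"
      using sum.shift_bounds_nat_ivl[of "\<lambda>n. f (Suc n)" 0 "k * m" m]
      by (simp add: atLeast0LessThan add.commute)
  qed simp
  finally show ?thesis .
qed

context
  fixes c :: "nat \<Rightarrow> nat"
  assumes c: "\<And>k. c k < 2 ^ (m - 2)"
begin

lemma deviation_tendsto_0: "deviation c \<longlonglongrightarrow> 0"
proof (rule steered_tendsto_0)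
  let ?B = "\<lambda>k. signed_sum m (block k) (word c k)"
  have word: "word c k \<in> steering_words m (block k) (deviation c k)" for k
    unfolding word_def by (rule h_steering) (rule c)
  show "deviation c (Suc k) = deviation c k + ?B k" for k
    by (simp add: word_def)
  show "?B k * deviation c k \<le> 0" for k
    using word[of k] by (simp add: steering_words_def)
  show "?B \<longlonglongrightarrow> 0"
  proof (rule tendsto_rabs_zero_cancel, rule tendsto_sandwich[OF _ _ tendsto_const block_sum_tendsto_0])
    show "\<forall>\<^sub>F k in sequentially. \<bar>?B k\<bar> \<le> (\<Sum>i<m. \<bar>block k i\<bar>)"
      unfolding signed_sum_def by (intro always_eventually allI sum_abs[THEN order_trans])
        (simp add: abs_mult)
  qed simp
  show "\<not> summable (\<lambda>k. \<bar>?B k\<bar>)"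
  proof
    assume B: "summable (\<lambda>k. \<bar>?B k\<bar>)"
    \<comment> \<open>Each of the \<open>m\<close> terms of a block is dominated by the block sum,
      so summable block sums would make \<open>a\<close> absolutely summable.\<close>
    have "(\<Sum>n<N. \<bar>a (Suc n)\<bar>) \<le> real m * (\<Sum>k. \<bar>?B k\<bar>)" for N
    proof -
      have "(\<Sum>n<N. \<bar>a (Suc n)\<bar>) \<le> (\<Sum>n<N * m. \<bar>a (Suc n)\<bar>)"
        using m by (intro sum_mono2) (auto intro: less_le_trans)
      also have "\<dots> = (\<Sum>n=1..N * m. \<bar>a n\<bar>)"
        by (simp add: sum.atLeast1_atMost_eq)
      also have "\<dots> = (\<Sum>k<N. \<Sum>i<m. \<bar>block k i\<bar>)"
        by (rule sum_blocks)
      also have "\<dots> \<le> (\<Sum>k<N. \<Sum>i<m. \<bar>?B k\<bar>)"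
        using word by (intro sum_mono) (auto simp: steering_words_def)
      also have "\<dots> = real m * (\<Sum>k<N. \<bar>?B k\<bar>)"
        by (simp add: sum_distrib_left)
      also have "\<dots> \<le> real m * (\<Sum>k. \<bar>?B k\<bar>)"
        using B by (intro mult_left_mono sum_le_suminf) auto
      finally show ?thesis .
    qed
    then have "summable (\<lambda>n. \<bar>a (Suc n)\<bar>)"
      by (intro summableI_nonneg_bounded) auto
    then show False using a_not_summable by simp
  qed
qed

text \<open>At block ends the partial sum is \<open>L\<close> plus the deviation; inside a block it
  differs from this by at most the absolute sum of that one block, which tends to 0.\<close>

lemma signs_sums_to: "(\<lambda>N. \<Sum>n=1..N. signs c n * a n) \<longlonglongrightarrow> L"
proof -
  let ?S = "\<lambda>N. \<Sum>n=1..N. signs c n * a n"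
  have S: "?S (K * m) = L + deviation c K" for K
  proof -
    have "?S (K * m) = (\<Sum>k<K. \<Sum>i<m. signs c (Suc (k * m + i)) * block k i)"
      by (rule sum_blocks)
    also have "\<dots> = (\<Sum>k<K. signed_sum m (block k) (word c k))"
      by (intro sum.cong) (auto simp: signed_sum_def signs_block simp del: mult_Suc)
    also have "\<dots> = L + deviation c K"
      by (induction K) (auto simp: word_def)
    finally show ?thesis .
  qed
  have bound: "\<bar>?S N - ?S (N div m * m)\<bar> \<le> (\<Sum>i<m. \<bar>block (N div m) i\<bar>)" for N
  proof -
    define K where "K = N div m"
    have N: "N = K * m + N mod m" "N mod m < m"
      using m by (simp_all add: K_def)
    have "?S N - ?S (K * m) = (\<Sum>n=K * m..<N. signs c (Suc n) * a (Suc n))"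
      using N by (simp add: sum.atLeast1_atMost_eq lessThan_atLeast0 sum_diff_nat_ivl)
    also have "\<dots> = (\<Sum>i<N mod m. signs c (Suc (K * m + i)) * block K i)"
      using N sum.shift_bounds_nat_ivl[of "\<lambda>n. signs c (Suc n) * a (Suc n)" 0 "K * m" "N mod m"]
      by (simp add: atLeast0LessThan add.commute)
    also have "\<bar>\<dots>\<bar> \<le> (\<Sum>i<N mod m. \<bar>block K i\<bar>)"
      using N by (intro sum_abs[THEN order_trans] sum_mono) (simp add: abs_mult signs_block)
    also have "\<dots> \<le> (\<Sum>i<m. \<bar>block K i\<bar>)"
      using N by (intro sum_mono2) auto
    finally show ?thesis by (simp add: K_def)
  qed
  have div: "filterlim (\<lambda>N. N div m) sequentially sequentially"
    using m by (intro filterlim_at_top_div_const_nat) simp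
  have "(\<lambda>N. \<Sum>i<m. \<bar>block (N div m) i\<bar>) \<longlonglongrightarrow> 0"
    using filterlim_compose[OF block_sum_tendsto_0 div] .
  then have "(\<lambda>N. ?S N - ?S (N div m * m)) \<longlonglongrightarrow> 0"
    by (rule Lim_null_comparison[rotated]) (use bound in auto)
  moreover have "(\<lambda>N. ?S (N div m * m)) \<longlonglongrightarrow> L"
    unfolding S using tendsto_add[OF tendsto_const filterlim_compose[OF deviation_tendsto_0 div], of L]
    by simp
  ultimately show ?thesis
    using tendsto_add by fastforce
qed

end

section \<open>Recovering a real number from its sign sequence\<close>

text \<open>Decoding proceeds block by block: equal earlier digits give equal deviations, so both
  sequences use the same injective map \<open>h k D\<close> in the next block, and equal words there
  give equal digits.\<close>

lemma digits_eq_if_signs_agree: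
  assumes c: "\<And>k. c k < 2 ^ (m - 2)" "\<And>k. c' k < 2 ^ (m - 2)"
    and agree: "\<And>n. n \<in> {1..K * m} \<Longrightarrow> signs c n = signs c' n"
    and "k < K"
  shows "c k = c' k"
proof -
  have digit: "c k = c' k" if k: "k < K" and D: "deviation c k = deviation c' k" for k
  proof -
    have w: "word c k \<subseteq> {..<m}" "word c' k \<subseteq> {..<m}"
      using h_steering c by (auto simp: word_def steering_words_def)
    have "i \<in> word c k \<longleftrightarrow> i \<in> word c' k" if i: "i < m" for i
    proof -
      have "Suc k * m \<le> K * m"
        using k by (intro mult_le_mono) auto
      then have "signs c (Suc (k * m + i)) = signs c' (Suc (k * m + i))"
        using i by (intro agree) auto
      then show ?thesis
        using i by (auto simp: signs_block sgn_of_def split: if_splits)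
    qed
    then have "word c k = word c' k"
      using w by blast
    then show ?thesis
      using h_inj[of k "deviation c k"] c D by (auto simp: word_def inj_on_def)
  qed
  have "deviation c k = deviation c' k" if "k \<le> K" for k
    using that by (induction k) (auto simp: digit)
  then show ?thesis
    using digit \<open>k < K\<close> by simp
qed

end

text \<open>The floor is the integer formed by the first \<open>K\<close> digits in base
  \<open>q\<close>; its remainder modulo \<open>q\<close> is the last digit, and division by
  \<open>q\<close> removes that digit.\<close>

lemma floor_power_eq_if_digits_eq:
  fixes x y :: real and q :: nat
  assumes "0 < q" "x \<in> {0..<1}" "y \<in> {0..<1}"
    and digits: "\<And>k. k < K \<Longrightarrow>
      \<lfloor>x * real q ^ Suc k\<rfloor> mod int q = \<lfloor>y * real q ^ Suc k\<rfloor> mod int q"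
  shows "\<lfloor>x * real q ^ K\<rfloor> = \<lfloor>y * real q ^ K\<rfloor>"
  using digits
proof (induction K)
  case 0
  have "\<lfloor>x\<rfloor> = 0" "\<lfloor>y\<rfloor> = 0"
    using assms by (auto simp: floor_eq_iff)
  then show ?case by simp
next
  case (Suc K)
  have "\<lfloor>z * real q ^ Suc K\<rfloor> div int q = \<lfloor>z * real q ^ K\<rfloor>" for z
    using floor_divide_real_eq_div[of "int q" "z * real q ^ Suc K"] assms(1) by simp
  then show ?case
    using Suc by (metis div_mult_mod_eq less_Suc_eq)
qed

text \<open>The base \<open>q\<close> digits of \<open>x\<close> choose the words. Agreement on
  \<open>K\<close> blocks of signs forces agreement of \<open>K\<close> digits, so a sign distance
  of about \<open>2 powr - (m * K)\<close> corresponds to a distance of at most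
  \<open>2 powr - ((m - 2) * K)\<close> in [0, 1).\<close>

lemma (in block_steering) ex_Hoelder_parametrisation:
  fixes s :: real
  defines "s \<equiv> (real m - 2) / real m"
  obtains g where
    "g ` {0..<1} \<subseteq> {\<epsilon> \<in> Signs. (\<lambda>N. \<Sum>n=1..N. \<epsilon> n * a n) \<longlonglongrightarrow> L}"
    "\<And>x y. x \<in> {0..<1} \<Longrightarrow> y \<in> {0..<1} \<Longrightarrow> \<bar>x - y\<bar> \<le> 2 ^ (m - 2) * rho (g x) (g y) powr s"
proof
  define q :: nat where "q = 2 ^ (m - 2)"
  have q: "2 \<le> q"
    unfolding q_def using m self_le_power[of "2::nat" "m - 2"] by simp
  define c where "c x k = nat (\<lfloor>x * real q ^ Suc k\<rfloor> mod int q)" for x :: real and k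
  have c: "c x k < 2 ^ (m - 2)" for x k
    using q by (simp add: c_def nat_less_iff flip: q_def)
  show "(\<lambda>x. signs (c x)) ` {0..<1} \<subseteq> {\<epsilon> \<in> Signs. (\<lambda>N. \<Sum>n=1..N. \<epsilon> n * a n) \<longlonglongrightarrow> L}"
    using signs_in_Signs signs_sums_to[OF c] by auto
  fix x y :: real assume xy: "x \<in> {0..<1}" "y \<in> {0..<1}"
  have close: "\<bar>x - y\<bar> \<le> 1 / real q ^ K"
    if agree: "\<And>n. n \<in> {1..K * m} \<Longrightarrow> signs (c x) n = signs (c y) n" for K
  proof -
    have "\<lfloor>x * real q ^ K\<rfloor> = \<lfloor>y * real q ^ K\<rfloor>"
    proof (rule floor_power_eq_if_digits_eq[OF _ xy])
      fix k assume "k < K"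
      then have "c x k = c y k"
        using digits_eq_if_signs_agree[OF c c agree] by blast
      then show "\<lfloor>x * real q ^ Suc k\<rfloor> mod int q = \<lfloor>y * real q ^ Suc k\<rfloor> mod int q"
        using q by (simp add: c_def nat_eq_iff2)
    qed (use q in simp)
    then have "\<bar>x * real q ^ K - y * real q ^ K\<bar> \<le> 1"
      by linarith
    then have "\<bar>x - y\<bar> * real q ^ K \<le> 1"
      by (simp add: abs_mult flip: left_diff_distrib)
    then show ?thesis
      using q by (simp add: field_simps)
  qed
  show "\<bar>x - y\<bar> \<le> 2 ^ (m - 2) * rho (signs (c x)) (signs (c y)) powr s"
  proof (cases "signs (c x) = signs (c y)")
    \<comment> \<open>Here the right-hand side is 0, so \<open>x = y\<close> is required; it follows
      from \<open>close\<close> for all \<open>K\<close>.\<close>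
    case True
    have "(\<lambda>K. (1 / real q) ^ K) \<longlonglongrightarrow> 0"
      using q by (intro LIMSEQ_realpow_zero) auto
    then have "\<bar>x - y\<bar> \<le> 0"
      using close True by (intro LIMSEQ_le_const) (auto simp: power_divide)
    then show ?thesis by (simp add: True rho_def)
  next
    case False
    define n where "n = (LEAST n. 1 \<le> n \<and> signs (c x) n \<noteq> signs (c y) n)"
    have n: "1 \<le> n"
      unfolding n_def by (rule LeastI2_ex[OF Signs_neq_ex[OF signs_in_Signs signs_in_Signs False]]) simp
    have rho: "rho (signs (c x)) (signs (c y)) = 2 powr - real n"
      using False by (simp add: rho_def n_def powr_minus powr_realpow divide_inverse)
    \<comment> \<open>This counts the complete blocks before the first disagreement
      \<open>n\<close>.\<close>
    define K where "K = (n - 1) div m"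
    have "signs (c x) i = signs (c y) i" if "i \<in> {1..K * m}" for i
    proof -
      have "K * m \<le> n - 1"
        by (simp add: K_def)
      then have "i < n"
        using that n by auto
      then show ?thesis
        using not_less_Least[of i "\<lambda>n. 1 \<le> n \<and> signs (c x) n \<noteq> signs (c y) n"] that
        by (auto simp: n_def)
    qed
    then have "\<bar>x - y\<bar> \<le> 1 / real q ^ K"
      by (rule close)
    also have "\<dots> = 2 powr - ((real m - 2) * real K)"
      using m by (simp add: q_def powr_minus divide_inverse of_nat_diff powr_powr flip: powr_realpow)
    \<comment> \<open>Since \<open>n \<le> (K + 1) * m\<close>, rounding down to complete blocks
      costs at most one block, which is the constant \<open>2 ^ (m - 2)\<close>.\<close>
    also have "\<dots> \<le> 2 powr ((real m - 2) + - real n * s)"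
    proof -
      have "n - 1 < (K + 1) * m"
        using m dividend_less_times_div[of m "n - 1"] by (simp add: K_def mult.commute)
      then have "n \<le> (K + 1) * m" by simp
      then have "real n \<le> (real K + 1) * real m"
        by (metis of_nat_1 of_nat_add of_nat_le_iff of_nat_mult)
      then have "real n / real m \<le> real K + 1"
        using m by (simp add: field_simps)
      then have "(real m - 2) * (real n / real m) \<le> (real m - 2) * (real K + 1)"
        using m by (intro mult_left_mono) auto
      then have "real n * s \<le> (real m - 2) * (real K + 1)"
        by (simp add: s_def mult.commute)
      then show ?thesis by (simp add: algebra_simps)
    qed
    also have "\<dots> = 2 ^ (m - 2) * rho (signs (c x)) (signs (c y)) powr s"
      unfolding powr_add using m by (simp add: rho powr_powr of_nat_diff flip: powr_realpow)
    finally show ?thesis .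
  qed
qed

theorem theorem1p2:
  fixes a :: "nat \<Rightarrow> real" and L :: real
  assumes "a \<longlonglongrightarrow> 0"
    and "\<not> summable (\<lambda>n. \<bar>a (Suc n)\<bar>)"
  shows "Signs.hausdorff_dim
           {\<epsilon> \<in> Signs. (\<lambda>N. \<Sum>n=1..N. \<epsilon> n * a n) \<longlonglongrightarrow> L} = 1"
proof (rule antisym)
  let ?A = "{\<epsilon> \<in> Signs. (\<lambda>N. \<Sum>n=1..N. \<epsilon> n * a n) \<longlonglongrightarrow> L}"
  show "Signs.hausdorff_dim ?A \<le> 1"
    by (rule hausdorff_dim_Signs_le_1) auto
  have "1 \<le> t" if t: "0 \<le> t" "Signs.hausdorff_measure t ?A = 0" for t
  proof (rule ccontr)
    assume "\<not> 1 \<le> t"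
    \<comment> \<open>The ceiling gives \<open>2 / m \<le> 1 - t\<close>, that is
      \<open>t \<le> s\<close>; adding 3 secures \<open>3 \<le> m\<close>.\<close>
    define m where "m = nat \<lceil>2 / (1 - t)\<rceil> + 3"
    have m: "3 \<le> m" by (simp add: m_def)
    define s where "s = (real m - 2) / real m"
    have "2 / (1 - t) \<le> real m"
      unfolding m_def by linarith
    then have ts: "t \<le> s" "0 < s"
      using m \<open>\<not> 1 \<le> t\<close> by (auto simp: s_def field_simps)
    \<comment> \<open>The lower bound on the number of steering words yields the injective encoding
      of digits for every block and every deviation.\<close>
    have "\<exists>f. f ` {..<(2::nat) ^ (m - 2)} \<subseteq> steering_words m b D \<and> inj_on f {..<2 ^ (m - 2)}" for b D
    proof (rule card_le_inj)
      show "card {..<(2::nat) ^ (m - 2)} \<le> card (steering_words m b D)"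
        using card_steering_words[of m b D] m by simp
    qed (auto simp: steering_words_def)
    then obtain f where f: "\<And>b D. f b D ` {..<(2::nat) ^ (m - 2)} \<subseteq> steering_words m b D"
      "\<And>b D. inj_on (f b D) {..<2 ^ (m - 2)}"
      by metis
    have h: "f b D c \<in> steering_words m b D" if "c < 2 ^ (m - 2)" for b D c
      using f(1) that by blast
    interpret block_steering a L m "\<lambda>k. f (\<lambda>i. a (Suc (k * m + i)))"
      by unfold_locales (simp_all add: assms m f(2) h)
    obtain g where "g ` {0..<1} \<subseteq> ?A"
      "\<And>x y. x \<in> {0..<1} \<Longrightarrow> y \<in> {0..<1} \<Longrightarrow> \<bar>x - y\<bar> \<le> 2 ^ (m - 2) * rho (g x) (g y) powr s"
      using ex_Hoelder_parametrisation unfolding s_def by blast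
    then have "Signs.hausdorff_measure t ?A \<noteq> 0"
      using t ts by (intro Signs.hausdorff_measure_neq_0[of g _ "2 ^ (m - 2)" t s]) auto
    then show False using t by simp
  qed
  then show "1 \<le> Signs.hausdorff_dim ?A"
    unfolding Signs.hausdorff_dim_def by (intro INF_greatest) (auto simp flip: ennreal_1)
qed

end
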